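(* Let $d\ge 2$ and put $n=d-1$, the number of fixed points of $\sigma_d(t)=dt \pmod 1$ on the circle $\mathbb{S}=\mathbb{R}/\mathbb{Z}$. The number of fixed point portraits for $\sigma_d$ is the Catalan number $$\frac{(2n)!}{(n+1)!\,n!}.$$
   Context: $\mathbb{S}=\mathbb{R}/\mathbb{Z}$ is identified with the boundary of the closed unit disk $\overline{\mathbb{D}}$, and $\sigma_d:\mathbb{S}\to\mathbb{S}$ is $\sigma_d(t)=dt\pmod 1$. Its fixed points are $\frac{i}{d-1}$, $0\le i<d-1$. A leaf is a chord of $\overline{\mathbb{D}}$; a fixed leaf is a chord joining two distinct fixed points. A fixed point portrait for $\sigma_d$ is a (possibly empty) collection of fixed leaves, obtained by connecting any number of the fixed points by leaves, such that two leaves meet, if at all, only at a fixed point (on $\mathbb{S}$), and such that if two leaves of the collection meet at a point, then they are part of the boundary of a fixed polygon (a polygon in the disk bounded by fixed leaves of the collection). Declaring two fixed points equivalent when they are joined by a finite chain of leaves of the portrait, the leaves of the portrait are exactly the boundary chords of the convex hulls of the equivalence classes (so no polygon has a diagonal drawn in, and distinct classes have disjoint convex hulls). Portraits are counted as distinct when their collections of leaves differ (no identification under rotation). *)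

theory Defs
  imports "HOL-Analysis.Analysis"
begin

text \<open>
  The circle \<open>\<real>/\<int>\<close> is represented by its fundamental domain \<open>[0,1)\<close>, so that
  reduction modulo 1 is the library function \<^const>\<open>frac\<close>.
\<close>

definition circle :: "real set" where
  "circle = {0..<1}"

definition sigma :: "nat \<Rightarrow> real \<Rightarrow> real" where
  "sigma d t = frac (real d * t)"

definition fixed_points :: "nat \<Rightarrow> real set" where
  "fixed_points d = {t \<in> circle. sigma d t = t}"

text \<open>The identification of \<open>\<real>/\<int>\<close> with the boundary of the closed unit disk in the complex plane.\<close>

definition bdry_pt :: "real \<Rightarrow> complex" where
  "bdry_pt t = cis (2 * pi * t)"

definition chord :: "real \<Rightarrow> real \<Rightarrow> complex set" where
  "chord s t = closed_segment (bdry_pt s) (bdry_pt t)"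

definition leaves :: "complex set set" where
  "leaves = {chord s t | s t. s \<in> circle \<and> t \<in> circle \<and> s \<noteq> t}"

definition fixed_leaves :: "nat \<Rightarrow> complex set set" where
  "fixed_leaves d = {chord s t | s t. s \<in> fixed_points d \<and> t \<in> fixed_points d \<and> s \<noteq> t}"

text \<open>
  A polygon all of whose sides belong to \<open>L\<close>.  When \<open>L\<close> consists of fixed leaves, its
  vertices are fixed points on the circle, so it is automatically convex and lies in the disk.
\<close>

definition fixed_polygon :: "complex set set \<Rightarrow> complex set \<Rightarrow> bool" where
  "fixed_polygon L P \<longleftrightarrow> polytope P \<and> aff_dim P = 2 \<and> (\<forall>F. F facet_of P \<longrightarrow> F \<in> L)"

text \<open>Fixed points joined by a finite (possibly empty) chain of leaves of \<open>L\<close>.\<close>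

definition leaf_equiv :: "nat \<Rightarrow> complex set set \<Rightarrow> (real \<times> real) set" where
  "leaf_equiv d L =
     {(s, t). s \<in> fixed_points d \<and> t \<in> fixed_points d \<and>
        (s, t) \<in> {(u, v). u \<in> fixed_points d \<and> v \<in> fixed_points d \<and> chord u v \<in> L}\<^sup>*}"

definition leaf_classes :: "nat \<Rightarrow> complex set set \<Rightarrow> real set set" where
  "leaf_classes d L = fixed_points d // leaf_equiv d L"

definition class_hull :: "real set \<Rightarrow> complex set" where
  "class_hull C = convex hull (bdry_pt ` C)"

text \<open>
  The boundary is taken in the plane: the hull of a two-point class is a chord, which equals
  its own frontier and hence is its only boundary chord; the hull of a one-point class has none.
\<close>

definition boundary_chords :: "complex set \<Rightarrow> complex set set" where
  "boundary_chords H = {l \<in> leaves. l \<subseteq> frontier H}"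

definition fixed_point_portrait :: "nat \<Rightarrow> complex set set \<Rightarrow> bool" where
  "fixed_point_portrait d L \<longleftrightarrow>
     L \<subseteq> fixed_leaves d \<and>
     (\<forall>l\<in>L. \<forall>m\<in>L. l \<noteq> m \<longrightarrow> l \<inter> m \<subseteq> bdry_pt ` fixed_points d) \<and>
     (\<forall>l\<in>L. \<forall>m\<in>L. l \<noteq> m \<and> l \<inter> m \<noteq> {} \<longrightarrow>
        (\<exists>P. fixed_polygon L P \<and> l \<subseteq> frontier P \<and> m \<subseteq> frontier P)) \<and>
     L = (\<Union>C\<in>leaf_classes d L. boundary_chords (class_hull C)) \<and>
     (\<forall>C\<in>leaf_classes d L. \<forall>D\<in>leaf_classes d L.
        C \<noteq> D \<longrightarrow> class_hull C \<inter> class_hull D = {})"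

lemma fixed_points_eq:
  assumes "d \<ge> 2"
  shows "fixed_points d = (\<lambda>i. real i / real (d - 1)) ` {..<d - 1}"
proof -
  obtain m where m: "d = Suc m" "m > 0" using assms by (cases d) auto
  have "t \<in> (\<lambda>i. real i / real m) ` {..<m}" if "t \<in> fixed_points d" for t
  proof -
    from that have t: "0 \<le> t" "t < 1" and fr: "frac (real d * t) = t"
      by (auto simp: fixed_points_def circle_def sigma_def)
    define i where "i = nat \<lfloor>real d * t\<rfloor>"
    have "\<lfloor>real d * t\<rfloor> \<ge> 0" using t by simp
    then have "real i = real d * t - t"
      using fr unfolding i_def frac_def by linarith
    then have i: "real i = real m * t" unfolding m by (simp add: distrib_right)
    moreover have "real m * t < real m * 1"
      using t m by (intro mult_strict_left_mono) auto
    ultimately have "i < m" by linarith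
    moreover have "t = real i / real m" using i m by simp
    ultimately show ?thesis by blast
  qed
  moreover have "real i / real m \<in> fixed_points d" if "i < m" for i
  proof -
    define t where "t = real i / real m"
    have t: "0 \<le> t" "t < 1" using that by (auto simp: t_def)
    have "real m * t = real i" using m by (simp add: t_def)
    then have "real d * t = t + of_int (int i)" unfolding m by (simp add: distrib_right)
    then have "frac (real d * t) = t" using t by (simp add: frac_unique_iff)
    then show ?thesis using t by (simp add: fixed_points_def circle_def sigma_def t_def)
  qed
  ultimately show ?thesis unfolding m by auto
qed

lemma card_fixed_points:
  assumes "d \<ge> 2"
  shows "card (fixed_points d) = d - 1"
proof -
  have "inj_on (\<lambda>i. real i / real (d - 1)) {..<d - 1}"
    using assms by (auto simp: inj_on_def)
  then show ?thesis unfolding fixed_points_eq[OF assms] by (subst card_image) auto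
qed

end

theory Submission
  imports Defs
begin

text \<open>
  A portrait is determined by the partition of the fixed points into the classes that its leaves
  connect, since its leaves are the boundary chords of the hulls of these classes. The disjointness
  of the hulls says that the partition is noncrossing, and every noncrossing partition occurs: the
  boundary chords of a hull connect its vertices in cyclic order, so drawing them recovers the
  classes. Portraits therefore correspond to noncrossing partitions of \<open>{0..<n}\<close>, whose number is
  the Catalan number.

  A partition of \<open>{0..<n}\<close> is encoded by the map \<open>f\<close> that sends each element to the least element of
  its block. In this encoding the noncrossing condition involves only two elements, and cutting a
  partition of \<open>{a..b}\<close> at the value \<open>f b\<close> splits it into two independent smaller ones
  (\<open>bij_betw_split_last\<close>). This yields Segner's recurrence, which the closed form satisfies
  (\<open>catalan_convolution\<close>).

  The geometry rests on one identity (\<open>inner_chord_normal\<close>), which expresses the side of a chord on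
  which a point of the circle lies by the signs of two sines. It separates the hulls of noncrossing
  blocks, makes crossing chords meet, and shows that chords between neighbouring points of a class
  bound its hull. The remaining portrait conditions use that a line has at most two points on the
  circle: so boundary chords of the same hull meet only in vertices (\<open>frontier_chords_meet\<close>), and the
  hull of three or more points is a polygon with boundary chords as sides
  (\<open>class_hull_fixed_polygon\<close>).
\<close>

section \<open>Catalan numbers and their convolution\<close>

definition catalan :: "nat \<Rightarrow> real" where
  "catalan n = fact (2 * n) / (fact (n + 1) * fact n)"

lemma catalan_0: "catalan 0 = 1"
  by (simp add: catalan_def)

lemma catalan_step: "real (n + 2) * catalan (Suc n) = real (4 * n + 2) * catalan n"
proof -
  have "fact (2 * Suc n) = (2 * real n + 2) * (2 * real n + 1) * (fact (2 * n) :: real)"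
    by (simp add: algebra_simps)
  note F = this
  have G: "fact (Suc n + 1) = (real n + 2) * (real n + 1) * (fact n :: real)"
    "fact (n + 1) = (real n + 1) * (fact n :: real)"
    "fact (Suc n) = (real n + 1) * (fact n :: real)"
    by (simp_all add: algebra_simps)
  have 1: "catalan (Suc n) = ((2 * real n + 2) * (2 * real n + 1) * fact (2 * n)) /
      ((real n + 2) * (real n + 1) * fact n * ((real n + 1) * fact n))"
    and 2: "catalan n = fact (2 * n) / ((real n + 1) * fact n * fact n)"
    by (simp_all only: catalan_def F G)
  have "real n + 1 \<noteq> 0" "real n + 2 \<noteq> 0" "(fact n :: real) \<noteq> 0" by linarith+ simp
  then show ?thesis unfolding 1 2 by (simp add: divide_simps) algebra
qed

text \<open>
  Let \<open>S m\<close> be the convolution and \<open>T m\<close> the same sum with the extra factor \<open>i\<close>. Reversing the order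
  of summation gives \<open>2 * T m = m * S m\<close>. Expanding \<open>T (Suc n) + S (Suc n)\<close>, in which the factor
  \<open>i + 1\<close> appears, with the first-order recurrence \<open>catalan_step\<close> expresses it by \<open>T n\<close> and \<open>S n\<close>.
  Together these give \<open>S\<close> the same first-order recurrence as the Catalan numbers.
\<close>
lemma catalan_convolution: "(\<Sum>i\<le>n. catalan i * catalan (n - i)) = catalan (Suc n)"
proof (induction n)
  case 0
  then show ?case using catalan_step[of 0] by (simp add: catalan_0)
next
  case (Suc n)
  define S where "S m = (\<Sum>i\<le>m. catalan i * catalan (m - i))" for m
  define T where "T m = (\<Sum>i\<le>m. real i * (catalan i * catalan (m - i)))" for m
  have T: "2 * T m = real m * S m" for m
  proof -
    have "T m = (\<Sum>i\<le>m. real (m - i) * (catalan (m - i) * catalan (m - (m - i))))"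
      unfolding T_def by (rule sum.reindex_bij_witness[of _ "\<lambda>i. m - i" "\<lambda>i. m - i"]) auto
    also have "\<dots> = (\<Sum>i\<le>m. (real m - real i) * (catalan i * catalan (m - i)))"
      by (intro sum.cong) (auto simp: of_nat_diff)
    also have "\<dots> = real m * S m - T m"
      unfolding S_def T_def by (simp add: left_diff_distrib sum_subtractf sum_distrib_left)
    finally show ?thesis by simp
  qed
  have "T (Suc n) + S (Suc n) =
      (\<Sum>i\<le>Suc n. real (i + 1) * catalan i * catalan (Suc n - i))"
    unfolding S_def T_def sum.distrib[symmetric] by (intro sum.cong) (auto simp: algebra_simps)
  also have "\<dots> = catalan (Suc n) + (\<Sum>i\<le>n. real (i + 2) * catalan (Suc i) * catalan (n - i))"
    by (subst sum.atMost_Suc_shift) (simp add: catalan_0 algebra_simps)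
  also have "(\<Sum>i\<le>n. real (i + 2) * catalan (Suc i) * catalan (n - i)) =
      (\<Sum>i\<le>n. 4 * (real i * (catalan i * catalan (n - i))) + 2 * (catalan i * catalan (n - i)))"
    unfolding catalan_step by (intro sum.cong) (auto simp: algebra_simps)
  also have "\<dots> = 4 * T n + 2 * S n"
    unfolding S_def T_def by (simp add: sum.distrib sum_distrib_left)
  finally have "T (Suc n) + S (Suc n) = catalan (Suc n) + 4 * T n + 2 * S n" by simp
  moreover have Sn: "S n = catalan (Suc n)" using Suc.IH by (simp add: S_def)
  ultimately have "2 * T (Suc n) + 2 * S (Suc n) = 2 * catalan (Suc n) + 4 * (2 * T n) + 4 * catalan (Suc n)"
    by simp
  then have "real (Suc n + 2) * S (Suc n) = real (4 * Suc n + 2) * catalan (Suc n)"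
    unfolding T Sn by (simp add: algebra_simps)
  also have "\<dots> = real (Suc n + 2) * catalan (Suc (Suc n))" by (rule catalan_step[symmetric])
  finally show ?case unfolding S_def by (metis mult_cancel_left of_nat_eq_0_iff add_is_0 numeral_eq_iff zero_neq_numeral)
qed

section \<open>Counting noncrossing partitions\<close>

text \<open>
  Noncrossing partitions of \<open>{a..<b}\<close>, with \<open>f i\<close> the least element of the block of \<open>i\<close>. If
  \<open>f j \<le> i < j\<close> but \<open>f i < f j\<close>, then \<open>f i < f j < i < j\<close> lie alternately in two blocks; conversely,
  of two crossing blocks, the one with the larger minimum contains such a \<open>j\<close>, with \<open>i\<close> in the other.
\<close>
definition block_min_maps :: "nat \<Rightarrow> nat \<Rightarrow> (nat \<Rightarrow> nat) set" where
  "block_min_maps a b = {f \<in> {a..<b} \<rightarrow>\<^sub>E {a..<b}.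
     (\<forall>i\<in>{a..<b}. f i \<le> i \<and> f (f i) = f i) \<and>
     (\<forall>i\<in>{a..<b}. \<forall>j\<in>{a..<b}. i < j \<and> f j \<le> i \<longrightarrow> f j \<le> f i)}"

lemma finite_block_min_maps: "finite (block_min_maps a b)"
  by (rule finite_subset[of _ "{a..<b} \<rightarrow>\<^sub>E {a..<b}"])
     (auto simp: block_min_maps_def intro: finite_PiE)

text \<open>
  If the last element \<open>b\<close> lies in the block of \<open>k = f b\<close>, then no block has elements on both sides of
  \<open>k\<close>: by minimality the block of \<open>k\<close> starts at \<open>k\<close>, and any other such block would cross it. So
  \<open>f\<close> consists of a partition of \<open>{a..<k}\<close> and one of \<open>{k..<b}\<close>, to whose first block \<open>b\<close> is
  added; if \<open>k = b\<close>, the second one is empty and \<open>b\<close> is a block of its own.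
\<close>
lemma bij_betw_split_last:
  assumes "a \<le> b"
  shows "bij_betw (\<lambda>f. (f b, restrict f {a..<f b}, restrict f {f b..<b}))
    (block_min_maps a (Suc b)) (SIGMA k:{a..b}. block_min_maps a k \<times> block_min_maps k b)"
proof (rule bij_betw_byWitness[where f' = "\<lambda>(k, g, h) i. if i < k then g i
    else if i < b then h i else if i = b then k else undefined"])
  show "\<forall>f\<in>block_min_maps a (Suc b). (\<lambda>(k, g, h) i. if i < k then g i
      else if i < b then h i else if i = b then k else undefined)
      (f b, restrict f {a..<f b}, restrict f {f b..<b}) = f"
    using assms by (auto simp: block_min_maps_def fun_eq_iff PiE_def extensional_def restrict_def)
  show "\<forall>x\<in>SIGMA k:{a..b}. block_min_maps a k \<times> block_min_maps k b.
      (\<lambda>f. (f b, restrict f {a..<f b}, restrict f {f b..<b})) ((\<lambda>(k, g, h) i. if i < k then g i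
      else if i < b then h i else if i = b then k else undefined) x) = x"
    using assms by (auto simp: block_min_maps_def fun_eq_iff PiE_def extensional_def restrict_def)
  show "(\<lambda>f. (f b, restrict f {a..<f b}, restrict f {f b..<b})) ` block_min_maps a (Suc b)
      \<subseteq> (SIGMA k:{a..b}. block_min_maps a k \<times> block_min_maps k b)"
  proof (rule image_subsetI)
    fix f assume f: "f \<in> block_min_maps a (Suc b)"
    have r: "f i \<in> {a..i}" "f (f i) = f i" if "i \<in> {a..b}" for i
      using f that by (auto simp: block_min_maps_def PiE_def Pi_def)
    have nc: "f j \<le> f i" if "i \<in> {a..b}" "j \<in> {a..b}" "i < j" "f j \<le> i" for i j
      using f that by (auto simp: block_min_maps_def)
    have k: "f b \<in> {a..b}" using r[of b] assms by auto
    have up: "f b \<le> f i" "f i < b" if "f b \<le> i" "i < b" for i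
      using nc[of i b] r[of i] that k by auto
    have "restrict f {a..<f b} \<in> block_min_maps a (f b)"
      unfolding block_min_maps_def using r nc k
      by (auto simp: le_less_trans)  (meson le_less_trans less_imp_le less_le_trans nc)+
    moreover have "restrict f {f b..<b} \<in> block_min_maps (f b) b"
      unfolding block_min_maps_def using r nc k up
      by (auto intro: le_less_trans)
    ultimately show "(f b, restrict f {a..<f b}, restrict f {f b..<b})
        \<in> (SIGMA k:{a..b}. block_min_maps a k \<times> block_min_maps k b)"
      using k by simp
  qed
  show "(\<lambda>(k, g, h) i. if i < k then g i else if i < b then h i else if i = b then k else undefined) `
      (SIGMA k:{a..b}. block_min_maps a k \<times> block_min_maps k b) \<subseteq> block_min_maps a (Suc b)"
  proof (clarsimp simp del: atLeastAtMost_iff)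
    fix k g h assume k: "k \<in> {a..b}" and g: "g \<in> block_min_maps a k" and h: "h \<in> block_min_maps k b"
    define f where "f i = (if i < k then g i else if i < b then h i else if i = b then k else undefined)" for i
    have g1: "g i \<in> {a..i}" "g (g i) = g i" if "i \<in> {a..<k}" for i
      using g that by (auto simp: block_min_maps_def PiE_def Pi_def)
    have h1: "h i \<in> {k..i}" "h (h i) = h i" if "i \<in> {k..<b}" for i
      using h that by (auto simp: block_min_maps_def PiE_def Pi_def)
    have lo: "f i = g i" if "i < k" for i using that by (simp add: f_def)
    have mid: "f i = h i" if "i \<in> {k..<b}" for i using that by (simp add: f_def)
    have top: "f b = k" using k by (simp add: f_def)
    have fk: "f k = k" using h1[of k] k mid[of k] top by (cases "k = b") auto
    have range: "f i \<in> {a..i} \<and> f (f i) = f i" if i: "i \<in> {a..b}" for i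
    proof -
      consider "i < k" | "i \<in> {k..<b}" | "i = b" using i by fastforce
      then show ?thesis
      proof cases
        case 1
        then show ?thesis using g1[of i] i lo[of i] lo[of "g i"] by auto
      next
        case 2
        then show ?thesis using h1[of i] i mid[of i] mid[of "h i"] k by auto
      qed (use top fk k i in auto)
    qed
    have nc: "f j \<le> f i" if ij: "i \<in> {a..b}" "j \<in> {a..b}" "i < j" "f j \<le> i" for i j
    proof -
      consider "j < k" | "j \<in> {k..<b}" | "j = b" using ij by fastforce
      then show ?thesis
      proof cases
        case 1
        then show ?thesis using g ij lo[of i] lo[of j] by (auto simp: block_min_maps_def)
      next
        case 2
        then have "i \<in> {k..<b}" using h1[of j] mid[of j] ij by auto
        then show ?thesis using h ij 2 mid[of i] mid[of j] by (auto simp: block_min_maps_def)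
      next
        case 3
        then have "i \<in> {k..<b}" using top ij by auto
        then show ?thesis using h1[of i] mid[of i] top 3 by auto
      qed
    qed
    have ext: "f \<in> extensional {a..<Suc b}"
      using g k by (auto simp: f_def extensional_def block_min_maps_def PiE_def)
    have "f \<in> block_min_maps a (Suc b)"
      unfolding block_min_maps_def PiE_def using range nc ext by (force simp: le_imp_less_Suc)
    then show "(\<lambda>i. if i < k then g i else if i < b then h i else if i = b then k else undefined)
        \<in> block_min_maps a (Suc b)"
      unfolding f_def .
  qed
qed

text \<open>
  The start \<open>a\<close> is arbitrary because the right-hand pieces of the splitting start at \<open>k\<close>.
\<close>
lemma card_block_min_maps: "real (card (block_min_maps a (a + m))) = catalan m"
proof (induction m arbitrary: a rule: less_induct)
  case (less m)
  show ?case
  proof (cases m)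
    case 0
    have "block_min_maps a a = {\<lambda>_. undefined}" by (auto simp: block_min_maps_def)
    then show ?thesis using 0 by (simp add: catalan_0)
  next
    case (Suc l)
    have "card (block_min_maps a (a + m)) =
        card (SIGMA k:{a..a+l}. block_min_maps a k \<times> block_min_maps k (a + l))"
      using bij_betw_same_card[OF bij_betw_split_last[of a "a + l"]] Suc by simp
    also have "\<dots> = (\<Sum>k\<in>{a..a+l}. card (block_min_maps a k) * card (block_min_maps k (a + l)))"
      by (subst card_SigmaI) (auto simp: finite_block_min_maps card_cartesian_product)
    also have "\<dots> = (\<Sum>i\<le>l. card (block_min_maps a (a + i)) * card (block_min_maps (a + i) (a + l)))"
      by (rule sum.reindex_bij_witness[of _ "\<lambda>i. a + i" "\<lambda>k. k - a"]) auto
    finally have "real (card (block_min_maps a (a + m))) =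
        (\<Sum>i\<le>l. real (card (block_min_maps a (a + i))) * real (card (block_min_maps (a + i) (a + l))))"
      by simp
    also have "\<dots> = (\<Sum>i\<le>l. catalan i * catalan (l - i))"
    proof (rule sum.cong)
      fix i assume "i \<in> {..l}"
      then show "real (card (block_min_maps a (a + i))) * real (card (block_min_maps (a + i) (a + l)))
          = catalan i * catalan (l - i)"
        using less[of i a] less[of "l - i" "a + i"] Suc by simp
    qed simp
    finally show ?thesis using catalan_convolution Suc by simp
  qed
qed

section \<open>Chords and convex hulls of points on the circle\<close>

lemma norm_bdry_pt [simp]: "norm (bdry_pt t) = 1"
  by (simp add: bdry_pt_def)

lemma inner_cis_cis: "inner (cis x) (cis y) = cos (x - y)"
  by (simp add: inner_complex_def cos_diff)

text \<open>
  The vector \<open>cis (pi * (u + v))\<close> is normal to the chord of \<open>u\<close> and \<open>v\<close>, whose line is the level set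
  \<open>cos (pi * (v - u))\<close>. For \<open>u = v\<close> it is the tangent at \<open>u\<close>. Parameters in
  \<^const>\<open>circle\<close> differ by less than 1, so each sine has the sign of its argument and the product
  tells on which side of the line the point \<open>w\<close> lies.
\<close>
lemma inner_chord_normal:
  "inner (cis (pi * (u + v))) (bdry_pt w) =
     cos (pi * (v - u)) + 2 * sin (pi * (w - u)) * sin (pi * (v - w))"
proof -
  have "pi * (w - u) - pi * (v - w) = 2 * pi * w - pi * (u + v)"
    "pi * (w - u) + pi * (v - w) = pi * (v - u)"
    by (simp_all add: algebra_simps)
  then have "2 * sin (pi * (w - u)) * sin (pi * (v - w)) =
      cos (2 * pi * w - pi * (u + v)) - cos (pi * (v - u))"
    using cos_diff[of "pi * (w - u)" "pi * (v - w)"] cos_add[of "pi * (w - u)" "pi * (v - w)"]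
    by simp
  moreover have "inner (cis (pi * (u + v))) (bdry_pt w) = cos (2 * pi * w - pi * (u + v))"
    by (subst inner_commute) (simp add: bdry_pt_def inner_cis_cis)
  ultimately show ?thesis by simp
qed

lemma sin_pi_mult_pos: "0 < x \<Longrightarrow> x < 1 \<Longrightarrow> sin (pi * x) > 0"
  by (intro sin_gt_zero) auto

lemma sin_pi_mult_neg: "x < 0 \<Longrightarrow> - 1 < x \<Longrightarrow> sin (pi * x) < 0"
  using sin_pi_mult_pos[of "- x"] by simp

lemma inner_inside:
  assumes "u \<in> circle" "v \<in> circle" "u < w" "w < v"
  shows "inner (cis (pi * (u + v))) (bdry_pt w) > cos (pi * (v - u))"
  unfolding inner_chord_normal
  using sin_pi_mult_pos[of "w - u"] sin_pi_mult_pos[of "v - w"] assms by (simp add: circle_def)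

lemma inner_endpoint:
  "inner (cis (pi * (u + v))) (bdry_pt u) = cos (pi * (v - u))"
  "inner (cis (pi * (u + v))) (bdry_pt v) = cos (pi * (v - u))"
  unfolding inner_chord_normal by simp_all

lemma inner_outside:
  assumes "u \<in> circle" "v \<in> circle" "w \<in> circle" "u \<le> v" "w < u \<or> v < w"
  shows "inner (cis (pi * (u + v))) (bdry_pt w) < cos (pi * (v - u))"
proof -
  have "sin (pi * (w - u)) * sin (pi * (v - w)) < 0"
    using assms(5)
  proof
    assume "w < u"
    then show ?thesis
      using sin_pi_mult_neg[of "w - u"] sin_pi_mult_pos[of "v - w"] assms
      by (intro mult_neg_pos) (auto simp: circle_def)
  next
    assume "v < w"
    then show ?thesis
      using sin_pi_mult_pos[of "w - u"] sin_pi_mult_neg[of "v - w"] assms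
      by (intro mult_pos_neg) (auto simp: circle_def)
  qed
  then show ?thesis unfolding inner_chord_normal mult.assoc by linarith
qed

lemma inner_class_hull:
  assumes "convex I" "\<And>w. w \<in> C \<Longrightarrow> inner a (bdry_pt w) \<in> I"
  shows "class_hull C \<subseteq> {x. inner a x \<in> I}"
proof -
  have "linear (inner a)" by (simp add: bounded_linear.linear bounded_linear_inner_right)
  then have "convex (inner a -` I)" using assms(1) by (rule convex_linear_vimage)
  then show ?thesis
    unfolding class_hull_def vimage_def using assms(2) by (intro hull_minimal) auto
qed

text \<open>
  The tangent at \<open>s\<close> keeps all other points of the circle strictly on one side.
\<close>
lemma bdry_pt_in_class_hull:
  assumes "C \<subseteq> circle" "s \<in> circle" "bdry_pt s \<in> class_hull C"
  shows "s \<in> C"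
proof (rule ccontr)
  assume "s \<notin> C"
  have "class_hull C \<subseteq> {x. inner (cis (pi * (s + s))) x \<in> {..<cos (pi * (s - s))}}"
  proof (rule inner_class_hull)
    fix w assume "w \<in> C"
    then show "inner (cis (pi * (s + s))) (bdry_pt w) \<in> {..<cos (pi * (s - s))}"
      using inner_outside[of s s w] assms \<open>s \<notin> C\<close> by (cases w s rule: linorder_cases) auto
  qed (rule convex_real_interval)
  then show False using assms(3) inner_endpoint(1)[of s s] by auto
qed

lemma bdry_pt_eq_iff:
  assumes "s \<in> circle" "t \<in> circle"
  shows "bdry_pt s = bdry_pt t \<longleftrightarrow> s = t"
  using bdry_pt_in_class_hull[of "{t}" s] assms by (auto simp: class_hull_def)

lemma chord_eq_iff:
  assumes "s \<in> circle" "t \<in> circle" "u \<in> circle" "v \<in> circle"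
  shows "chord s t = chord u v \<longleftrightarrow> {s, t} = {u, v}"
  using assms by (auto simp: chord_def doubleton_eq_iff bdry_pt_eq_iff)

lemma chord_commute: "chord s t = chord t s"
  by (simp add: chord_def closed_segment_commute)

text \<open>
  The line through the ends of the arc separates the two hulls; it may touch only the hull of \<open>D\<close>.
\<close>
lemma class_hulls_disjoint_of_arc:
  assumes "C \<subseteq> circle" "D \<subseteq> circle" "u \<in> circle" "v \<in> circle" "u \<le> v"
    and "D \<subseteq> {u..v}" "C \<inter> {u..v} = {}"
  shows "class_hull C \<inter> class_hull D = {}"
proof -
  let ?a = "cis (pi * (u + v))" and ?b = "cos (pi * (v - u))"
  have "class_hull C \<subseteq> {x. inner ?a x \<in> {..<?b}}"
  proof (rule inner_class_hull)
    fix w assume "w \<in> C"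
    then show "inner ?a (bdry_pt w) \<in> {..<?b}"
      using inner_outside[of u v w] assms by fastforce
  qed (rule convex_real_interval)
  moreover have "class_hull D \<subseteq> {x. inner ?a x \<in> {?b..}}"
  proof (rule inner_class_hull)
    fix w assume "w \<in> D"
    then have "w = u \<or> w = v \<or> (u < w \<and> w < v)" using assms by fastforce
    then show "inner ?a (bdry_pt w) \<in> {?b..}"
      using inner_inside[of u v w] inner_endpoint[of u v] assms(3,4) by fastforce
  qed (rule convex_real_interval)
  ultimately show ?thesis by (force simp: not_less)
qed

text \<open>
  A line meets the closed disk in a chord. Rotating by \<open>cnj (cis (pi * (a + c)))\<close> makes the chord
  vertical, with end points \<open>cis (- \<delta>)\<close> and \<open>cis \<delta>\<close>.
\<close>
lemma mem_chord:
  assumes "0 < c - a" "c - a < 1" "norm x \<le> 1"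
    and "inner (cis (pi * (a + c))) x = cos (pi * (c - a))"
  shows "x \<in> chord a c"
proof -
  define h where "h = cis (pi * (a + c))"
  define \<delta> where "\<delta> = pi * (c - a)"
  define z where "z = cnj h * x"
  have "h * cnj h = 1" by (simp add: h_def cis_cnj cis_mult)
  then have x: "x = h * z" unfolding z_def by (simp add: mult.assoc[symmetric])
  have z: "norm z \<le> 1" using assms(3) by (simp add: z_def norm_mult h_def)
  have re: "Re z = cos \<delta>" using assms(4) by (simp add: z_def h_def inner_complex_def \<delta>_def)
  have s: "sin \<delta> > 0" unfolding \<delta>_def using assms by (intro sin_pi_mult_pos) auto
  have "(cos \<delta>)\<^sup>2 + (Im z)\<^sup>2 \<le> 1" using z re by (simp add: cmod_def)
  then have "(Im z)\<^sup>2 \<le> (sin \<delta>)\<^sup>2" using re sin_cos_squared_add[of \<delta>] by linarith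
  then have im: "\<bar>Im z\<bar> \<le> sin \<delta>" using s abs_le_square_iff[of "Im z" "sin \<delta>"] by simp
  \<comment> \<open>the parameter on the vertical chord at which the imaginary part is \<open>Im z\<close>\<close>
  define r where "r = (1 + Im z / sin \<delta>) / 2"
  have "- 1 \<le> Im z / sin \<delta>" "Im z / sin \<delta> \<le> 1" using im s by (simp_all add: le_divide_eq divide_le_eq)
  then have r: "0 \<le> r" "r \<le> 1" unfolding r_def by (simp_all add: divide_le_eq)
  have "z = (1 - r) *\<^sub>R cis (- \<delta>) + r *\<^sub>R cis \<delta>"
    using s by (simp add: complex_eq_iff re r_def field_simps)
  moreover have "bdry_pt a = h * cis (- \<delta>)" "bdry_pt c = h * cis \<delta>"
    unfolding bdry_pt_def h_def \<delta>_def cis_mult by (simp_all add: algebra_simps)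
  ultimately have "x = (1 - r) *\<^sub>R bdry_pt a + r *\<^sub>R bdry_pt c"
    unfolding x by (simp add: distrib_left mult_scaleR_right)
  then show ?thesis using r unfolding chord_def in_segment by blast
qed

text \<open>
  The end points of one chord lie on different sides of the line of the other, so that chord crosses
  the line, and does so inside the disk.
\<close>
lemma crossing_chords_meet:
  assumes "a \<in> circle" "e \<in> circle" "a < b" "b < c" "c < e"
  shows "chord a c \<inter> chord b e \<noteq> {}"
proof -
  let ?h = "cis (pi * (a + c))" and ?k = "cos (pi * (c - a))"
  have circ: "b \<in> circle" "c \<in> circle" using assms by (auto simp: circle_def)
  have "connected (chord b e)" by (simp add: chord_def)
  moreover have "bdry_pt b \<in> chord b e" "bdry_pt e \<in> chord b e" by (simp_all add: chord_def)
  moreover have "inner ?h (bdry_pt e) \<le> ?k" "?k \<le> inner ?h (bdry_pt b)"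
    using inner_outside[of a c e] inner_inside[of a c b] assms circ by auto
  ultimately obtain x where x: "x \<in> chord b e" "inner ?h x = ?k"
    using connected_ivt_hyperplane by blast
  have "chord b e \<subseteq> cball 0 1"
    unfolding chord_def by (intro closed_segment_subset) auto
  then have "norm x \<le> 1" using x by auto
  then have "x \<in> chord a c" using mem_chord x assms by (auto simp: circle_def)
  then show ?thesis using x by blast
qed

text \<open>
  In the coordinate \<open>cnj a * z\<close> the line fixes the real part and the circle fixes the norm, so only
  the sign of the imaginary part is free.
\<close>
lemma line_meets_circle_twice:
  fixes a p q r :: complex
  assumes "a \<noteq> 0" "norm p = 1" "norm q = 1" "norm r = 1"
    and "inner a p = b" "inner a q = b" "inner a r = b"
  shows "p = q \<or> p = r \<or> q = r"
proof -
  have im: "(Im (cnj a * z))\<^sup>2 = (norm a)\<^sup>2 - b\<^sup>2 \<and> Re (cnj a * z) = b" if "norm z = 1" "inner a z = b" for z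
  proof -
    have "Re (cnj a * z) = b" using that by (simp add: inner_complex_def)
    moreover have "(Re (cnj a * z))\<^sup>2 + (Im (cnj a * z))\<^sup>2 = (norm a)\<^sup>2"
      using that by (simp add: cmod_power2[symmetric] norm_mult del: times_complex.simps)
    ultimately show ?thesis by simp
  qed
  have "cnj a * p = cnj a * q \<or> cnj a * p = cnj a * r \<or> cnj a * q = cnj a * r"
    using im[of p] im[of q] im[of r] assms(2-) unfolding complex_eq_iff
    by (metis power2_eq_iff)
  then show ?thesis using assms(1) by auto
qed

lemma boundary_chord_endpoints:
  assumes "C \<subseteq> circle" "finite C" "l \<in> boundary_chords (class_hull C)"
  obtains s t where "s \<in> C" "t \<in> C" "s \<noteq> t" "l = chord s t" "l \<subseteq> class_hull C"
proof -
  from assms(3) obtain s t where st: "s \<in> circle" "t \<in> circle" "s \<noteq> t" "l = chord s t"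
    "l \<subseteq> frontier (class_hull C)"
    by (auto simp: boundary_chords_def leaves_def)
  have "closed (class_hull C)"
    unfolding class_hull_def using assms(2) by (simp add: compact_imp_closed compact_convex_hull finite_imp_compact)
  then have sub: "l \<subseteq> class_hull C" using st(5) frontier_subset_closed by blast
  moreover have "bdry_pt s \<in> l" "bdry_pt t \<in> l" by (simp_all add: st(4) chord_def)
  ultimately have "s \<in> C" "t \<in> C" using bdry_pt_in_class_hull assms(1) st by blast+
  then show ?thesis using that st sub by blast
qed

lemma chord_subset_class_hull:
  assumes "s \<in> C" "t \<in> C"
  shows "chord s t \<subseteq> class_hull C"
  unfolding chord_def class_hull_def using assms
  by (intro closed_segment_subset) (auto intro: hull_inc)

text \<open>
  The line of a chord between neighbouring points of \<open>C\<close> has no point of \<open>C\<close> on the side of the arc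
  between them, so it supports the hull.
\<close>
lemma consecutive_chord:
  assumes "C \<subseteq> circle" "u \<in> C" "v \<in> C" "u < v" "C \<inter> {u<..<v} = {}"
  shows "chord u v \<in> boundary_chords (class_hull C)"
proof -
  let ?h = "cis (pi * (u + v))" and ?k = "cos (pi * (v - u))"
  have "class_hull C \<subseteq> {x. inner ?h x \<in> {..?k}}"
  proof (rule inner_class_hull)
    fix w assume "w \<in> C"
    then have "w = u \<or> w = v \<or> w < u \<or> v < w" using assms(5) by force
    then show "inner ?h (bdry_pt w) \<in> {..?k}"
      using inner_outside[of u v w] inner_endpoint[of u v] assms \<open>w \<in> C\<close> by fastforce
  qed (rule convex_real_interval)
  then have "interior (class_hull C) \<subseteq> interior {x. inner ?h x \<le> ?k}"
    by (intro interior_mono) auto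
  then have int: "interior (class_hull C) \<subseteq> {x. inner ?h x < ?k}"
    by (simp add: cis_neq_zero)
  have "chord u v = class_hull {u, v}"
    by (simp add: chord_def class_hull_def segment_convex_hull)
  also have "\<dots> \<subseteq> {x. inner ?h x \<in> {?k}}"
    using inner_endpoint[of u v] by (intro inner_class_hull convex_singleton) auto
  finally have "chord u v \<inter> interior (class_hull C) = {}" using int by fastforce
  moreover have "chord u v \<subseteq> class_hull C" using assms chord_subset_class_hull by blast
  ultimately have "chord u v \<subseteq> frontier (class_hull C)"
    unfolding frontier_def using closure_subset by fastforce
  then show ?thesis using assms by (auto simp: boundary_chords_def leaves_def)
qed

text \<open>
  This form covers sets with empty interior, such as the hull of two points: a hyperplane that
  contains the set supports it.
\<close>
lemma supporting_hyperplane_at: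
  fixes S :: "'a::euclidean_space set"
  assumes "convex S" "x \<in> closure S" "x \<notin> interior S"
  obtains a where "a \<noteq> 0" "\<And>y. y \<in> S \<Longrightarrow> inner a x \<le> inner a y"
proof (cases "x \<in> rel_interior S")
  case True
  then have "interior S = {}" "x \<in> S"
    using assms(3) rel_interior_nonempty_interior rel_interior_subset by blast+
  then obtain a b where "a \<noteq> 0" "S \<subseteq> {x. inner a x = b}"
    using empty_interior_subset_hyperplane[OF assms(1)] by blast
  then show ?thesis using that[of a] \<open>x \<in> S\<close> by (metis (mono_tags, lifting) mem_Collect_eq order_refl subset_iff)
next
  case False
  then show ?thesis
    using supporting_hyperplane_relative_frontier[OF assms(1,2)] that closure_subset[of S]
    by (metis subsetD)
qed

text \<open>
  A line supporting the hull at a common point that is not a vertex contains both chords, because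
  the point is interior to each of them. The line has at most two points on the circle, so the two
  chords have the same end points.
\<close>
lemma frontier_chords_meet:
  assumes "C \<subseteq> circle" "finite C"
    and "l \<in> boundary_chords (class_hull C)" "m \<in> boundary_chords (class_hull C)" "l \<noteq> m"
  shows "l \<inter> m \<subseteq> bdry_pt ` C"
proof (rule subsetI, rule ccontr)
  fix x assume x: "x \<in> l \<inter> m" and nx: "x \<notin> bdry_pt ` C"
  obtain s t where st: "s \<in> C" "t \<in> C" "s \<noteq> t" "l = chord s t" "l \<subseteq> class_hull C"
    using boundary_chord_endpoints assms by metis
  obtain u v where uv: "u \<in> C" "v \<in> C" "u \<noteq> v" "m = chord u v" "m \<subseteq> class_hull C"
    using boundary_chord_endpoints assms by metis
  have "x \<in> frontier (class_hull C)" using x assms(3) by (auto simp: boundary_chords_def)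
  then have "x \<notin> interior (class_hull C)" "x \<in> closure (class_hull C)"
    by (auto simp: frontier_def)
  moreover have "convex (class_hull C)" by (simp add: class_hull_def)
  ultimately obtain a where a: "a \<noteq> 0" "\<And>y. y \<in> class_hull C \<Longrightarrow> inner a x \<le> inner a y"
    using supporting_hyperplane_at by metis
  \<comment> \<open>a linear functional with its minimum over a segment at an inner point is constant on it\<close>
  have ends: "inner a (bdry_pt p) = inner a x \<and> inner a (bdry_pt q) = inner a x"
    if pq: "p \<in> C" "q \<in> C" "x \<in> chord p q" for p q
  proof -
    have "bdry_pt p \<in> class_hull C" "bdry_pt q \<in> class_hull C"
      using pq by (auto simp: class_hull_def intro: hull_inc)
    then have le: "inner a x \<le> inner a (bdry_pt p)" "inner a x \<le> inner a (bdry_pt q)"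
      using a by auto
    from pq(3) obtain r where r: "0 \<le> r" "r \<le> 1" "x = (1 - r) *\<^sub>R bdry_pt p + r *\<^sub>R bdry_pt q"
      by (auto simp: chord_def in_segment)
    have "r \<noteq> 0" "r \<noteq> 1" using r nx pq by auto
    then have r': "0 < r" "r < 1" using r by auto
    have "(1 - r) * (inner a (bdry_pt p) - inner a x) + r * (inner a (bdry_pt q) - inner a x) = 0"
      using arg_cong[OF r(3), of "inner a"] by (simp add: inner_add_right algebra_simps)
    moreover have "0 \<le> (1 - r) * (inner a (bdry_pt p) - inner a x)"
      "0 \<le> r * (inner a (bdry_pt q) - inner a x)"
      using le r' by simp_all
    ultimately have "(1 - r) * (inner a (bdry_pt p) - inner a x) = 0"
      "r * (inner a (bdry_pt q) - inner a x) = 0" by linarith+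
    then show ?thesis using r' by simp
  qed
  have "w = s \<or> w = t" if "w \<in> {u, v}" for w
    using line_meets_circle_twice[of a "bdry_pt s" "bdry_pt t" "bdry_pt w"]
      ends[of s t] ends[of u v] st uv x a(1) that assms(1)
    by (auto simp: bdry_pt_eq_iff subset_iff)
  then have "{u, v} = {s, t}" using uv(3) by blast
  then show False using assms(5) st(4) uv(4) by (metis chord_commute doubleton_eq_iff)
qed

text \<open>
  Three points of the circle are not collinear, so the hull is two-dimensional. A facet is spanned
  by the vertices on it; these lie on a line, so there are exactly two and the facet is a chord. As
  a proper face it avoids the interior.
\<close>
lemma class_hull_fixed_polygon:
  assumes "C \<subseteq> circle" "finite C" and L: "boundary_chords (class_hull C) \<subseteq> L"
    and pqr: "p \<in> C" "q \<in> C" "r \<in> C" "p \<noteq> q" "p \<noteq> r" "q \<noteq> r"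
  shows "fixed_polygon L (class_hull C)"
  unfolding fixed_polygon_def
proof (intro conjI allI impI)
  show "polytope (class_hull C)"
    unfolding class_hull_def polytope_def
    by (intro exI[of _ "bdry_pt ` C"]) (simp add: assms(2))
  have inH: "bdry_pt w \<in> class_hull C" if "w \<in> C" for w
    using that by (auto simp: class_hull_def intro: hull_inc)
  have "\<not> aff_dim (class_hull C) < DIM(complex)"
  proof
    assume "aff_dim (class_hull C) < DIM(complex)"
    then obtain a b where ab: "a \<noteq> 0" "class_hull C \<subseteq> {x. inner a x = b}"
      by (rule aff_lowdim_subset_hyperplane)
    then have "inner a (bdry_pt w) = b" if "w \<in> C" for w using inH that by blast
    then show False
      using line_meets_circle_twice[of a "bdry_pt p" "bdry_pt q" "bdry_pt r"] ab(1) pqr assms(1)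
      by (auto simp: bdry_pt_eq_iff subset_iff)
  qed
  then show dim: "aff_dim (class_hull C) = 2"
    using aff_dim_le_DIM[of "class_hull C"] by simp
  fix F assume F: "F facet_of class_hull C"
  then have face: "F face_of class_hull C" and "aff_dim F = 1"
    using dim by (auto simp: facet_of_def)
  obtain S where S: "S \<subseteq> bdry_pt ` C" "F = convex hull S"
    using face_of_convex_hull_subset[of "bdry_pt ` C" F] face assms(2)
    by (auto simp: class_hull_def finite_imp_compact)
  have "aff_dim S = 1" using \<open>aff_dim F = 1\<close> S by (simp add: aff_dim_convex_hull)
  have "S \<noteq> {}" using \<open>aff_dim S = 1\<close> by auto
  moreover have "\<nexists>x. S = {x}" using \<open>aff_dim S = 1\<close> by auto
  ultimately obtain x y where xy: "x \<in> S" "y \<in> S" "x \<noteq> y" by blast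
  have "S \<subseteq> {x, y}"
  proof
    fix z assume "z \<in> S"
    obtain a b where ab: "a \<noteq> 0" "S \<subseteq> {x. inner a x = b}"
      using aff_lowdim_subset_hyperplane[of S] \<open>aff_dim S = 1\<close> by auto
    have "norm w = 1" if "w \<in> S" for w using that S by auto
    then show "z \<in> {x, y}"
      using line_meets_circle_twice[of a x y z b] ab xy \<open>z \<in> S\<close> by blast
  qed
  then have "S = {x, y}" using xy by auto
  then obtain s t where st: "s \<in> C" "t \<in> C" "x = bdry_pt s" "y = bdry_pt t"
    using S by blast
  have "F = chord s t" using \<open>S = {x, y}\<close> S st by (simp add: chord_def segment_convex_hull)
  moreover have "F \<subseteq> frontier (class_hull C)"
  proof -
    have "F \<noteq> class_hull C" using \<open>aff_dim F = 1\<close> dim by auto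
    then have "F \<inter> interior (class_hull C) = {}" using face face_of_disjoint_interior by blast
    moreover have "F \<subseteq> class_hull C" using face face_of_imp_subset by blast
    ultimately show ?thesis unfolding frontier_def using closure_subset by blast
  qed
  ultimately have "F \<in> boundary_chords (class_hull C)"
    using st xy assms(1) by (auto simp: boundary_chords_def leaves_def)
  then show "F \<in> L" using L by blast
qed

section \<open>Portraits and block-minimum maps\<close>

definition fixed_pt :: "nat \<Rightarrow> nat \<Rightarrow> real" where
  "fixed_pt n i = real i / real n"

lemma fixed_pt_less_iff: "n > 0 \<Longrightarrow> fixed_pt n i < fixed_pt n j \<longleftrightarrow> i < j"
  by (simp add: fixed_pt_def divide_less_cancel)

lemma fixed_pt_le_iff: "n > 0 \<Longrightarrow> fixed_pt n i \<le> fixed_pt n j \<longleftrightarrow> i \<le> j"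
  by (simp add: fixed_pt_def divide_le_cancel)

lemma fixed_pt_eq_iff: "n > 0 \<Longrightarrow> fixed_pt n i = fixed_pt n j \<longleftrightarrow> i = j"
  by (simp add: fixed_pt_def)

lemma fixed_pt_in_circle: "i < n \<Longrightarrow> fixed_pt n i \<in> circle"
  by (simp add: fixed_pt_def circle_def)

definition block :: "nat \<Rightarrow> (nat \<Rightarrow> nat) \<Rightarrow> nat \<Rightarrow> real set" where
  "block n f i = fixed_pt n ` {j. j < n \<and> f j = f i}"

definition map_leaves :: "nat \<Rightarrow> (nat \<Rightarrow> nat) \<Rightarrow> complex set set" where
  "map_leaves n f = (\<Union>i<n. boundary_chords (class_hull (block n f i)))"

lemma block_subset_circle: "block n f i \<subseteq> circle"
  by (auto simp: block_def fixed_pt_in_circle)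

lemma finite_block: "finite (block n f i)"
  by (simp add: block_def)

lemma mem_block: "n > 0 \<Longrightarrow> j < n \<Longrightarrow> fixed_pt n j \<in> block n f i \<longleftrightarrow> f j = f i"
  by (auto simp: block_def fixed_pt_eq_iff)

text \<open>
  The block with the larger minimum lies in the arc from its least to its greatest element, and the
  noncrossing condition for that greatest element keeps the other block out of the arc.
\<close>
lemma block_hulls_disjoint_less:
  assumes f: "f \<in> block_min_maps 0 n" and ij: "i < n" "j < n" "f i < f j"
  shows "class_hull (block n f i) \<inter> class_hull (block n f j) = {}"
proof -
  have n: "n > 0" using ij by simp
  let ?B = "{k. k < n \<and> f k = f j}"
  define e where "e = Max ?B"
  have "j \<in> ?B" using ij by simp
  then have "e \<in> ?B" unfolding e_def by (intro Max_in) auto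
  then have e: "e < n" "f e = f j" by auto
  have le_e: "k \<le> e" if "k \<in> ?B" for k using that unfolding e_def by (intro Max_ge) auto
  have f_le: "f k \<le> k" if "k < n" for k using f that by (auto simp: block_min_maps_def)
  then have fj: "f j < n" "f j \<le> e" using e ij(2) by (metis le_less_trans)+
  show ?thesis
  proof (rule class_hulls_disjoint_of_arc[of _ _ "fixed_pt n (f j)" "fixed_pt n e"])
    show "block n f j \<subseteq> {fixed_pt n (f j)..fixed_pt n e}"
      using f_le le_e by (force simp: block_def fixed_pt_le_iff n)
    show "block n f i \<inter> {fixed_pt n (f j)..fixed_pt n e} = {}"
    proof -
      have False if "k < n" "f k = f i" "f j \<le> k" "k \<le> e" for k
      proof -
        have "k \<noteq> e" using that e ij by auto
        then have "k < e" "f e \<le> k" using that e by simp_all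
        moreover have "\<forall>i\<in>{0..<n}. \<forall>j\<in>{0..<n}. i < j \<and> f j \<le> i \<longrightarrow> f j \<le> f i"
          using f by (simp add: block_min_maps_def)
        moreover have "k \<in> {0..<n}" "e \<in> {0..<n}" using that(1) e(1) by simp_all
        ultimately have "f e \<le> f k" by blast
        then show False using that e ij by simp
      qed
      then show ?thesis by (auto simp: block_def fixed_pt_le_iff n)
    qed
  qed (use block_subset_circle fixed_pt_in_circle fixed_pt_le_iff n e fj in auto)
qed

lemma block_hulls_disjoint:
  assumes "f \<in> block_min_maps 0 n" "i < n" "j < n" "f i \<noteq> f j"
  shows "class_hull (block n f i) \<inter> class_hull (block n f j) = {}"
  using block_hulls_disjoint_less[of f n i j] block_hulls_disjoint_less[of f n j i] assms
  by (auto simp: neq_iff)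

lemma fixed_points_fixed_pt: "d \<ge> 2 \<Longrightarrow> n = d - 1 \<Longrightarrow> fixed_points d = fixed_pt n ` {..<n}"
  by (simp add: fixed_points_eq fixed_pt_def image_def)

lemma equiv_leaf_equiv: "equiv (fixed_points d) (leaf_equiv d L)"
proof (rule equivI)
  let ?R = "{(u, v). u \<in> fixed_points d \<and> v \<in> fixed_points d \<and> chord u v \<in> L}"
  have "sym ?R" by (auto simp: sym_def chord_commute)
  then have "sym (?R\<^sup>*)" by (rule sym_rtrancl)
  then show "sym (leaf_equiv d L)" by (auto simp: leaf_equiv_def sym_def)
  show "trans (leaf_equiv d L)" by (auto simp: leaf_equiv_def trans_def)
qed (auto simp: leaf_equiv_def refl_on_def)

lemma leaf_equiv_sym: "(s, t) \<in> leaf_equiv d L \<Longrightarrow> (t, s) \<in> leaf_equiv d L"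
  using equiv_leaf_equiv[of d L] by (meson equivE symD)

lemma leaf_equiv_trans:
  "(s, t) \<in> leaf_equiv d L \<Longrightarrow> (t, u) \<in> leaf_equiv d L \<Longrightarrow> (s, u) \<in> leaf_equiv d L"
  using equiv_leaf_equiv[of d L] by (meson equivE transD)

lemma leaf_equiv_refl: "s \<in> fixed_points d \<Longrightarrow> (s, s) \<in> leaf_equiv d L"
  by (simp add: leaf_equiv_def)

lemma leaf_classes_blocks:
  assumes "d \<ge> 2" "n = d - 1"
    and "\<And>i j. i < n \<Longrightarrow> j < n \<Longrightarrow> (fixed_pt n i, fixed_pt n j) \<in> leaf_equiv d L \<longleftrightarrow> f i = f j"
  shows "leaf_classes d L = block n f ` {..<n}"
proof -
  have "leaf_equiv d L `` {fixed_pt n i} = block n f i" if "i < n" for i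
  proof -
    have "leaf_equiv d L `` {fixed_pt n i} \<subseteq> fixed_pt n ` {..<n}"
      using fixed_points_fixed_pt[OF assms(1,2)] by (auto simp: leaf_equiv_def)
    then show ?thesis using assms(3)[OF that] by (fastforce simp: block_def)
  qed
  then show ?thesis
    unfolding leaf_classes_def quotient_def fixed_points_fixed_pt[OF assms(1,2)] by auto
qed

text \<open>
  Drawing the boundary chords of the blocks recovers the blocks: both ends of each chord lie in one
  block, and neighbouring points of a block are joined, so by induction on the number of points in
  between any two points of a block are connected.
\<close>
lemma leaf_equiv_map_leaves:
  assumes d: "d \<ge> 2" "n = d - 1" and f: "f \<in> block_min_maps 0 n" and ij: "i < n" "j < n"
  shows "(fixed_pt n i, fixed_pt n j) \<in> leaf_equiv d (map_leaves n f) \<longleftrightarrow> f i = f j"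
proof
  have n: "n > 0" using d by simp
  note fp = fixed_points_fixed_pt[OF d]
  let ?R = "{(u, v). u \<in> fixed_points d \<and> v \<in> fixed_points d \<and> chord u v \<in> map_leaves n f}"
  {
    assume "(fixed_pt n i, fixed_pt n j) \<in> leaf_equiv d (map_leaves n f)"
    then have "(fixed_pt n i, fixed_pt n j) \<in> ?R\<^sup>*" by (auto simp: leaf_equiv_def)
    then have "fixed_pt n j \<in> block n f i"
    proof (induction rule: rtrancl_induct)
      case base
      show ?case using ij by (simp add: mem_block n)
    next
      case (step u v)
      from step(2) obtain k where k: "k < n" "chord u v \<in> boundary_chords (class_hull (block n f k))"
        by (auto simp: map_leaves_def)
      have uv: "u \<in> circle" "v \<in> circle" using step(2) by (auto simp: fixed_points_def)
      obtain s t where "s \<in> block n f k" "t \<in> block n f k" "chord u v = chord s t"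
        using boundary_chord_endpoints[OF block_subset_circle finite_block k(2)] by metis
      then have "u \<in> block n f k" "v \<in> block n f k"
        using uv block_subset_circle[of n f k] by (auto simp: chord_eq_iff subset_iff doubleton_eq_iff)
      moreover have "block n f k = block n f i"
        using \<open>u \<in> block n f k\<close> step(3) by (auto simp: block_def fixed_pt_eq_iff n)
      ultimately show ?case by simp
    qed
    then show "f i = f j" using ij by (simp add: mem_block n)
  }
  have connected: "(s, t) \<in> leaf_equiv d (map_leaves n f)"
    if "s \<in> block n f i" "t \<in> block n f i" "s < t" for s t
    using that
  proof (induction "card (block n f i \<inter> {s<..<t})" arbitrary: s t rule: less_induct)
    case less
    show ?case
    proof (cases "block n f i \<inter> {s<..<t} = {}")
      case True
      then have "chord s t \<in> map_leaves n f"
        using consecutive_chord[OF block_subset_circle less.prems] ij by (auto simp: map_leaves_def)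
      moreover have "s \<in> fixed_points d" "t \<in> fixed_points d"
        using less.prems by (auto simp: fp block_def)
      ultimately show ?thesis by (auto simp: leaf_equiv_def)
    next
      case False
      then obtain w where w: "w \<in> block n f i" "s < w" "w < t" by auto
      have "card (block n f i \<inter> {s<..<w}) < card (block n f i \<inter> {s<..<t})"
        "card (block n f i \<inter> {w<..<t}) < card (block n f i \<inter> {s<..<t})"
        using w finite_block[of n f i] by (intro psubset_card_mono; force)+
      then have "(s, w) \<in> leaf_equiv d (map_leaves n f)" "(w, t) \<in> leaf_equiv d (map_leaves n f)"
        using less.hyps[of s w] less.hyps[of w t] less.prems(1,2) w by simp_all
      then show ?thesis by (rule leaf_equiv_trans)
    qed
  qed
  assume "f i = f j"
  then have "fixed_pt n i \<in> block n f i" "fixed_pt n j \<in> block n f i"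
    using ij by (simp_all add: mem_block n)
  then have "(fixed_pt n i, fixed_pt n j) \<in> leaf_equiv d (map_leaves n f) \<or>
      (fixed_pt n j, fixed_pt n i) \<in> leaf_equiv d (map_leaves n f) \<or> fixed_pt n i = fixed_pt n j"
    using connected by (metis linorder_less_linear)
  moreover have "fixed_pt n i \<in> fixed_points d" using ij by (simp add: fp)
  ultimately show "(fixed_pt n i, fixed_pt n j) \<in> leaf_equiv d (map_leaves n f)"
    using leaf_equiv_refl leaf_equiv_sym by metis
qed

text \<open>
  Leaves of different blocks are disjoint, so leaves that meet bound the hull of the same block. If
  they differ, that block has a third point, and its hull is the required polygon.
\<close>
lemma portrait_of_map:
  assumes d: "d \<ge> 2" "n = d - 1" and f: "f \<in> block_min_maps 0 n"
  shows "fixed_point_portrait d (map_leaves n f)"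
  unfolding fixed_point_portrait_def
proof (intro conjI ballI impI)
  have n: "n > 0" using d by simp
  note fp = fixed_points_fixed_pt[OF d]
  have classes: "leaf_classes d (map_leaves n f) = block n f ` {..<n}"
    using leaf_classes_blocks[OF d] leaf_equiv_map_leaves[OF d f] by blast
  have block_fixed: "block n f i \<subseteq> fixed_points d" for i by (auto simp: block_def fp)
  have disj: "class_hull (block n f i) \<inter> class_hull (block n f j) = {}"
    if "i < n" "j < n" "block n f i \<noteq> block n f j" for i j
  proof (rule block_hulls_disjoint[OF f that(1,2)])
    show "f i \<noteq> f j" using that(3) by (metis block_def)
  qed
  show "map_leaves n f \<subseteq> fixed_leaves d"
  proof
    fix l assume "l \<in> map_leaves n f"
    then obtain i where "l \<in> boundary_chords (class_hull (block n f i))"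
      by (auto simp: map_leaves_def)
    then obtain s t where "s \<in> block n f i" "t \<in> block n f i" "s \<noteq> t" "l = chord s t"
      using boundary_chord_endpoints[OF block_subset_circle finite_block] by metis
    then show "l \<in> fixed_leaves d" using block_fixed by (auto simp: fixed_leaves_def)
  qed
  show "map_leaves n f = (\<Union>C\<in>leaf_classes d (map_leaves n f). boundary_chords (class_hull C))"
    unfolding classes by (auto simp: map_leaves_def)
  show "class_hull C \<inter> class_hull D = {}"
    if "C \<in> leaf_classes d (map_leaves n f)" "D \<in> leaf_classes d (map_leaves n f)" "C \<noteq> D" for C D
    using that disj unfolding classes by auto
  have same_block: "\<exists>i<n. l \<in> boundary_chords (class_hull (block n f i)) \<and>
      m \<in> boundary_chords (class_hull (block n f i))"
    if lm: "l \<in> map_leaves n f" "m \<in> map_leaves n f" "l \<inter> m \<noteq> {}" for l m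
  proof -
    obtain i j where ij: "i < n" "j < n" "l \<in> boundary_chords (class_hull (block n f i))"
      "m \<in> boundary_chords (class_hull (block n f j))"
      using lm(1,2) unfolding map_leaves_def by blast
    then have "l \<subseteq> class_hull (block n f i)" "m \<subseteq> class_hull (block n f j)"
      using boundary_chord_endpoints[OF block_subset_circle finite_block] by metis+
    then have "block n f i = block n f j" using disj[OF ij(1,2)] lm(3) by blast
    then show ?thesis using ij by auto
  qed
  fix l m assume lm: "l \<in> map_leaves n f" "m \<in> map_leaves n f"
  show "l \<inter> m \<subseteq> bdry_pt ` fixed_points d" if "l \<noteq> m"
  proof (cases "l \<inter> m = {}")
    case False
    then obtain i where "l \<in> boundary_chords (class_hull (block n f i))"
      "m \<in> boundary_chords (class_hull (block n f i))"
      using same_block lm by blast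
    then show ?thesis
      using frontier_chords_meet[OF block_subset_circle finite_block] that block_fixed by blast
  qed simp
  assume "l \<noteq> m \<and> l \<inter> m \<noteq> {}"
  then obtain i where i: "i < n" "l \<in> boundary_chords (class_hull (block n f i))"
    "m \<in> boundary_chords (class_hull (block n f i))" "l \<noteq> m"
    using same_block lm by blast
  obtain s t where st: "s \<in> block n f i" "t \<in> block n f i" "s \<noteq> t" "l = chord s t"
    using boundary_chord_endpoints[OF block_subset_circle finite_block i(2)] by metis
  obtain u v where uv: "u \<in> block n f i" "v \<in> block n f i" "u \<noteq> v" "m = chord u v"
    using boundary_chord_endpoints[OF block_subset_circle finite_block i(3)] by metis
  have "{s, t} \<noteq> {u, v}" using i(4) st(4) uv(4) by (metis chord_commute doubleton_eq_iff)
  then obtain w where "w \<in> block n f i" "w \<noteq> s" "w \<noteq> t" using st uv by blast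
  moreover have "boundary_chords (class_hull (block n f i)) \<subseteq> map_leaves n f"
    using i(1) by (auto simp: map_leaves_def)
  ultimately have "fixed_polygon (map_leaves n f) (class_hull (block n f i))"
    using class_hull_fixed_polygon[OF block_subset_circle finite_block _ st(1,2)] st(3) by metis
  moreover have "l \<subseteq> frontier (class_hull (block n f i))" "m \<subseteq> frontier (class_hull (block n f i))"
    using i by (auto simp: boundary_chords_def)
  ultimately show "\<exists>P. fixed_polygon (map_leaves n f) P \<and> l \<subseteq> frontier P \<and> m \<subseteq> frontier P"
    by blast
qed

text \<open>
  The map sends each index to the least index in its class. A violation of the noncrossing condition
  would give two crossing chords that join points of two different classes, and so a common point of
  their hulls.
\<close>
lemma map_of_portrait:
  assumes d: "d \<ge> 2" "n = d - 1" and L: "fixed_point_portrait d L"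
  shows "\<exists>f\<in>block_min_maps 0 n. L = map_leaves n f"
proof -
  have n: "n > 0" using d by simp
  note fp = fixed_points_fixed_pt[OF d]
  let ?E = "leaf_equiv d L"
  have refl: "(fixed_pt n i, fixed_pt n i) \<in> ?E" if "i < n" for i
    using that by (simp add: leaf_equiv_refl fp)
  define m where "m i = (LEAST k. (fixed_pt n k, fixed_pt n i) \<in> ?E)" for i
  define f where "f = restrict m {0..<n}"
  have f_E: "(fixed_pt n (f i), fixed_pt n i) \<in> ?E" and f_le: "f i \<le> i" if "i < n" for i
    using LeastI[of "\<lambda>k. (fixed_pt n k, fixed_pt n i) \<in> ?E" i] refl[OF that]
      Least_le[of "\<lambda>k. (fixed_pt n k, fixed_pt n i) \<in> ?E" i] that
    by (auto simp: f_def m_def)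
  have f_eq: "(fixed_pt n i, fixed_pt n j) \<in> ?E \<longleftrightarrow> f i = f j" if ij: "i < n" "j < n" for i j
  proof
    assume "(fixed_pt n i, fixed_pt n j) \<in> ?E"
    then have "(fixed_pt n k, fixed_pt n i) \<in> ?E \<longleftrightarrow> (fixed_pt n k, fixed_pt n j) \<in> ?E" for k
      using leaf_equiv_sym leaf_equiv_trans by metis
    then show "f i = f j" using ij by (simp add: f_def m_def)
  next
    assume "f i = f j"
    then show "(fixed_pt n i, fixed_pt n j) \<in> ?E"
      using f_E[OF ij(1)] f_E[OF ij(2)] leaf_equiv_sym leaf_equiv_trans by metis
  qed
  have idem: "f (f i) = f i" if "i < n" for i
    using f_eq[of "f i" i] f_E[OF that] f_le[OF that] that by simp
  have classes: "leaf_classes d L = block n f ` {..<n}"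
    using leaf_classes_blocks[OF d] f_eq by blast
  note portrait = L[unfolded fixed_point_portrait_def, THEN conjunct2, THEN conjunct2, THEN conjunct2]
  have union: "L = (\<Union>C\<in>leaf_classes d L. boundary_chords (class_hull C))"
    by (rule conjunct1[OF portrait])
  have disj: "\<forall>C\<in>leaf_classes d L. \<forall>D\<in>leaf_classes d L.
      C \<noteq> D \<longrightarrow> class_hull C \<inter> class_hull D = {}"
    by (rule conjunct2[OF portrait])
  have "f j \<le> f i" if ij: "i < j" "j < n" "f j \<le> i" for i j
  proof (rule ccontr)
    assume "\<not> f j \<le> f i"
    then have less: "f i < f j" by simp
    have "f j \<noteq> i" using idem[of j] ij less by auto
    let ?p = "fixed_pt n"
    have "f i < n" "f j < n" using f_le[of i] f_le[of j] ij by auto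
    have meet: "chord (?p (f i)) (?p i) \<inter> chord (?p (f j)) (?p j) \<noteq> {}"
      using less \<open>f j \<noteq> i\<close> ij fixed_pt_less_iff[OF n] \<open>f i < n\<close>
      by (intro crossing_chords_meet fixed_pt_in_circle) auto
    have sub: "chord (?p (f i)) (?p i) \<subseteq> class_hull (block n f i)"
      "chord (?p (f j)) (?p j) \<subseteq> class_hull (block n f j)"
      using idem ij \<open>f i < n\<close> \<open>f j < n\<close> by (intro chord_subset_class_hull; simp add: mem_block n)+
    have "block n f i \<noteq> block n f j"
      using mem_block[OF n, of i f i] mem_block[OF n, of i f j] ij less by auto
    moreover have "block n f i \<in> leaf_classes d L" "block n f j \<in> leaf_classes d L"
      using ij unfolding classes by auto
    ultimately have "class_hull (block n f i) \<inter> class_hull (block n f j) = {}"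
      using disj by blast
    then show False using meet sub by blast
  qed
  moreover have "f i < n" if "i < n" for i using f_le[OF that] that by simp
  then have "f \<in> {0..<n} \<rightarrow>\<^sub>E {0..<n}" by (auto simp: PiE_def f_def)
  ultimately have "f \<in> block_min_maps 0 n"
    using f_le idem by (auto simp: block_min_maps_def)
  moreover have "L = map_leaves n f"
    using union unfolding classes map_leaves_def by simp
  ultimately show ?thesis by blast
qed

text \<open>
  Equal leaf sets have the same classes, and a map is determined by its classes as it sends each
  index to the least one in its class.
\<close>
lemma inj_map_leaves:
  assumes d: "d \<ge> 2" "n = d - 1"
  shows "inj_on (map_leaves n) (block_min_maps 0 n)"
proof (rule inj_onI)
  fix f g assume f: "f \<in> block_min_maps 0 n" and g: "g \<in> block_min_maps 0 n"
    and eq: "map_leaves n f = map_leaves n g"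
  have same: "f i = f j \<longleftrightarrow> g i = g j" if "i < n" "j < n" for i j
    using leaf_equiv_map_leaves[OF d f that] leaf_equiv_map_leaves[OF d g that] eq by simp
  have props: "h i \<le> i" "h (h i) = h i" if "h \<in> block_min_maps 0 n" "i < n" for h i
    using that by (auto simp: block_min_maps_def)
  have "f i = g i" if i: "i < n" for i
  proof (rule antisym)
    have "f (g i) = f i" "g (f i) = g i"
      using same[of "g i" i] same[of "f i" i] props[OF f i] props[OF g i] i by auto
    moreover have "f i < n" "g i < n" using props[OF f i] props[OF g i] i by auto
    ultimately show "f i \<le> g i" "g i \<le> f i" using props[OF f, of "g i"] props[OF g, of "f i"] by auto
  qed
  then show "f = g"
    using f g by (intro PiE_ext[of f "{0..<n}" _ g]) (auto simp: block_min_maps_def)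
qed

theorem theorem2p5:
  fixes d n :: nat
  assumes "d \<ge> 2" and "n = d - 1"
  shows "real (card {L. fixed_point_portrait d L}) = fact (2 * n) / (fact (n + 1) * fact n)"
proof -
  have "{L. fixed_point_portrait d L} = map_leaves n ` block_min_maps 0 n"
    using portrait_of_map[OF assms] map_of_portrait[OF assms] by blast
  then have "card {L. fixed_point_portrait d L} = card (block_min_maps 0 n)"
    using inj_map_leaves[OF assms] by (simp add: card_image)
  then show ?thesis using card_block_min_maps[of 0 n] by (simp add: catalan_def)
qed

end
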